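(* Let $(\boldsymbol\varphi,\boldsymbol p,\mathbf R,\boldsymbol\sigma)(S,t)$ be a smooth solution of the equations of motion $$\frac{\partial\boldsymbol\varphi}{\partial t}=\mathbb A^{-1}\boldsymbol p,\quad \frac{\partial\boldsymbol p}{\partial t}=\frac{\partial(\mathbb G\boldsymbol\varepsilon)}{\partial S},\quad \frac{\partial\mathbf R}{\partial t}=\mathbf R\,j^{-1}(\mathbb J^{-1}\boldsymbol\sigma),\quad \frac{\partial\boldsymbol\sigma}{\partial t}=\frac{\partial(\mathbb H\boldsymbol\kappa)}{\partial S}+\frac{\partial\boldsymbol\varphi}{\partial S}\wedge(\mathbb G\boldsymbol\varepsilon).$$ Then for any test function $f:(\mathbb R^3)^{[0,L]}\to\mathbb R$, $$\frac{\partial}{\partial t}f(\boldsymbol\kappa(t))=\int_0^L\Big\langle\frac{\partial f}{\partial\boldsymbol\kappa},\frac{\partial\boldsymbol\omega}{\partial S}+\boldsymbol\omega\wedge\boldsymbol\kappa\Big\rangle dS,$$ where $\boldsymbol\omega=\mathbb J^{-1}\boldsymbol\sigma$.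
   Context: $S\in[0,L]$; $\boldsymbol\varphi,\boldsymbol p,\boldsymbol\sigma$ are $\mathbb R^3$-valued and $\mathbf R$ is $SO(3)$-valued. $\langle\cdot,\cdot\rangle$ is the Euclidean scalar product of $\mathbb R^3$ and $\wedge$ the cross product. $(\boldsymbol e_1,\boldsymbol e_2,\boldsymbol e_3)$ is a fixed positively oriented orthonormal basis, identified with the canonical basis of $\mathbb R^3$; the moving frame is $\boldsymbol d_i=\mathbf R\boldsymbol e_i$. A bold vector $\boldsymbol u=u_i\boldsymbol d_i$ is a vector of the ambient $\mathbb R^3$ with moving-frame components $u=\mathbf R^{-1}\boldsymbol u$; derivatives of bold vectors are those of $\mathbb R^3$-valued functions (the frame is differentiated too). The map $j:so(3)\to\mathbb R^3$ sends a skew matrix $A$ to the column $a$ with $Ax=a\wedge x$ for all $x$; with bold vectors, $j^{-1}(\boldsymbol u)$ means the skew matrix $j^{-1}(u)$ built on the moving components. The curvature $\boldsymbol\kappa$ is the bold vector with moving components $j(\mathbf R^{-1}\partial_S\mathbf R)$ and the strain-vector is $\boldsymbol\varepsilon=\partial_S\boldsymbol\varphi-\boldsymbol d_3$. The tensors are diagonal with constant positive entries in the moving frame: $\mathbb G=\mathrm{diag}(GA,GA,EA)$, $\mathbb H=\mathrm{diag}(EI_1,EI_2,GI_3)$, $\mathbb A=\rho A\,\mathrm{Id}$, $\mathbb J=\rho\,\mathrm{diag}(I_1,I_2,I_3)$; $\mathbb X\boldsymbol u$ is the bold vector with moving components $\mathbb Xu$. A test function $f$ is a differentiable functional of an $\mathbb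 R^3$-valued field on $[0,L]$, with gradient $\partial f/\partial\boldsymbol\kappa$ defined by $df(\boldsymbol\kappa)\cdot\delta\boldsymbol\kappa=\int_0^L\langle\partial f/\partial\boldsymbol\kappa,\delta\boldsymbol\kappa\rangle dS$. *)

theory Defs
  imports "HOL-Analysis.Analysis"
begin

text \<open>
  Smoothness on a set \<open>X\<close> which need not be open.  It is only used for convex sets with
  nonempty interior (\<open>[0,L]\<close> and \<open>[0,L] \<times> T\<close>), where the derivative within \<open>X\<close> is unique also
  at boundary points.
\<close>

primrec Ck_on ::
  "nat \<Rightarrow> 'a::real_normed_vector set \<Rightarrow> ('a \<Rightarrow> 'b::real_normed_vector) \<Rightarrow> bool" where
  "Ck_on 0 X f = continuous_on X f"
| "Ck_on (Suc k) X f =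
    (\<exists>f'. (\<forall>x\<in>X. (f has_derivative f' x) (at x within X)) \<and> (\<forall>v. Ck_on k X (\<lambda>x. f' x v)))"

definition smooth_on ::
  "'a::real_normed_vector set \<Rightarrow> ('a \<Rightarrow> 'b::real_normed_vector) \<Rightarrow> bool" where
  "smooth_on X f \<longleftrightarrow> (\<forall>k. Ck_on k X f)"

text \<open>Partial derivatives, one-sided at the end points of \<open>[0,L]\<close> and of the time interval \<open>T\<close>.\<close>

definition dS :: "real \<Rightarrow> (real \<Rightarrow> real \<Rightarrow> 'b::real_normed_vector) \<Rightarrow> real \<Rightarrow> real \<Rightarrow> 'b" where
  "dS L F S t = vector_derivative (\<lambda>s. F s t) (at S within {0..L})"

definition dt :: "real set \<Rightarrow> (real \<Rightarrow> real \<Rightarrow> 'b::real_normed_vector) \<Rightarrow> real \<Rightarrow> real \<Rightarrow> 'b" where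
  "dt T F S t = vector_derivative (\<lambda>\<tau>. F S \<tau>) (at t within T)"

definition so3 :: "(real^3^3) set" where
  "so3 = {M. transpose M = - M}"

definition j_map :: "real^3^3 \<Rightarrow> real^3" where
  "j_map M = (THE a. \<forall>x. M *v x = cross3 a x)"

definition j_inv :: "real^3 \<Rightarrow> real^3^3" where
  "j_inv = the_inv_into so3 j_map"

definition diag3 :: "real \<Rightarrow> real \<Rightarrow> real \<Rightarrow> real^3^3" where
  "diag3 a b c = (\<chi> i k. if i = k then vector [a, b, c] $ i else 0)"

text \<open>
  Bold vectors are represented by their ambient values; \<open>moving R\<close> gives the components in the
  frame \<open>d\<^sub>i = R e\<^sub>i\<close>, \<open>bold R\<close> is the converse, and \<open>tensor R X\<close> is the action
  on bold vectors of the tensor with constant matrix \<open>X\<close> in the moving frame.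
\<close>

definition moving ::
  "(real \<Rightarrow> real \<Rightarrow> real^3^3) \<Rightarrow> (real \<Rightarrow> real \<Rightarrow> real^3) \<Rightarrow> real \<Rightarrow> real \<Rightarrow> real^3" where
  "moving R u S t = matrix_inv (R S t) *v u S t"

definition bold ::
  "(real \<Rightarrow> real \<Rightarrow> real^3^3) \<Rightarrow> (real \<Rightarrow> real \<Rightarrow> real^3) \<Rightarrow> real \<Rightarrow> real \<Rightarrow> real^3" where
  "bold R u S t = R S t *v u S t"

definition tensor ::
  "(real \<Rightarrow> real \<Rightarrow> real^3^3) \<Rightarrow> real^3^3 \<Rightarrow> (real \<Rightarrow> real \<Rightarrow> real^3) \<Rightarrow> real \<Rightarrow> real \<Rightarrow> real^3" where
  "tensor R X u = bold R (\<lambda>S t. X *v moving R u S t)"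

definition curvature ::
  "real \<Rightarrow> (real \<Rightarrow> real \<Rightarrow> real^3^3) \<Rightarrow> real \<Rightarrow> real \<Rightarrow> real^3" where
  "curvature L R = bold R (\<lambda>S t. j_map (matrix_inv (R S t) ** dS L R S t))"

definition strain ::
  "real \<Rightarrow> (real \<Rightarrow> real \<Rightarrow> real^3) \<Rightarrow> (real \<Rightarrow> real \<Rightarrow> real^3^3) \<Rightarrow> real \<Rightarrow> real \<Rightarrow> real^3" where
  "strain L \<phi> R S t = dS L \<phi> S t - R S t *v axis 3 1"

text \<open>
  Fields on \<open>[0,L]\<close> are functions on the whole real line of which only the values on \<open>[0,L]\<close>
  matter: the \<open>C\<^sup>k\<close> norm below ignores all other values, so a functional that is differentiable
  in the sense of \<open>has_functional_derivative\<close> is unchanged when a field is modified outside \<open>[0,L]\<close>.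
\<close>

definition Ck_norm :: "nat \<Rightarrow> real \<Rightarrow> (real \<Rightarrow> 'b::real_normed_vector) \<Rightarrow> real" where
  "Ck_norm k L h = (\<Sum>i\<le>k. SUP S\<in>{0..L}.
     norm (((\<lambda>u s. vector_derivative u (at s within {0..L})) ^^ i) h S))"

text \<open>
  Frechet differentiability on the space of smooth fields, with respect to the \<open>C\<^sup>k\<close> norm
  for some \<open>k\<close>.  It holds in particular for functionals that are Frechet differentiable for the sup
  norm, for an \<open>L\<^sup>2\<close> norm, or for a norm that also controls derivatives of the field.
\<close>

definition has_functional_derivative ::
  "real \<Rightarrow> ((real \<Rightarrow> real^3) \<Rightarrow> real) \<Rightarrow> ((real \<Rightarrow> real^3) \<Rightarrow> real) \<Rightarrow> (real \<Rightarrow> real^3) \<Rightarrow> bool" where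
  "has_functional_derivative L f df u \<longleftrightarrow>
    (\<forall>h1 h2. smooth_on {0..L} h1 \<longrightarrow> smooth_on {0..L} h2 \<longrightarrow>
       df (\<lambda>S. h1 S + h2 S) = df h1 + df h2) \<and>
    (\<forall>c h. smooth_on {0..L} h \<longrightarrow> df (\<lambda>S. c *\<^sub>R h S) = c * df h) \<and>
    (\<exists>k. (\<exists>C. \<forall>h. smooth_on {0..L} h \<longrightarrow> \<bar>df h\<bar> \<le> C * Ck_norm k L h) \<and>
         (\<forall>e>0. \<exists>d>0. \<forall>h. smooth_on {0..L} h \<longrightarrow> Ck_norm k L h < d \<longrightarrow>
            \<bar>f (\<lambda>S. u S + h S) - f u - df h\<bar> \<le> e * Ck_norm k L h))"

definition has_functional_gradient ::
  "real \<Rightarrow> ((real \<Rightarrow> real^3) \<Rightarrow> real) \<Rightarrow> (real \<Rightarrow> real^3) \<Rightarrow> (real \<Rightarrow> real^3) \<Rightarrow> bool" where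
  "has_functional_gradient L f g u \<longleftrightarrow>
    (\<exists>df. has_functional_derivative L f df u \<and>
      (\<forall>h. smooth_on {0..L} h \<longrightarrow> ((\<lambda>S. g S \<bullet> h S) has_integral df h) {0..L}))"

end

theory Submission
  imports Defs
begin

text \<open>
  With \<open>\<partial>\<^sub>S(Rx) = \<kappa> \<and> Rx\<close> and \<open>\<partial>\<^sub>t(Rx) = \<omega> \<and> Rx\<close>
  for constant \<open>x\<close>, the symmetry of mixed derivatives and the Jacobi identity give
  \<open>\<partial>\<^sub>t\<kappa> = \<partial>\<^sub>S\<omega> + \<omega> \<and> \<kappa>\<close>.  Since \<open>S\<close> ranges over a compact interval, the difference quotients of
  \<open>\<kappa>\<close> in \<open>t\<close> converge to \<open>\<partial>\<^sub>t\<kappa>\<close> in every \<open>C\<^sup>k\<close> norm, so the Frechet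
  derivative of \<open>f\<close> obeys the chain rule along \<open>t \<mapsto> \<kappa>(t)\<close>.
\<close>

section \<open>Calculus of smooth maps\<close>

text \<open>Derivatives within \<open>X\<close> see only values on \<open>X\<close>. This carries
  smoothness over to fields that are given by a usable formula only on the strip.\<close>

lemma Ck_on_cong:
  assumes "Ck_on k X f" "\<And>x. x \<in> X \<Longrightarrow> f x = g x"
  shows "Ck_on k X g"
proof (cases k)
  case 0
  then show ?thesis using assms continuous_on_cong[of X X f g] by simp
next
  case (Suc n)
  then show ?thesis
    using assms by simp (metis has_derivative_transform)
qed

lemma Ck_on_Suc_D: "Ck_on (Suc k) X f \<Longrightarrow> Ck_on k X f"
proof (induction k arbitrary: f)
  case 0
  then show ?case
    by (auto simp: continuous_on_eq_continuous_within intro: has_derivative_continuous)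
next
  case (Suc k)
  then show ?case by (metis Ck_on.simps(2))
qed

lemma Ck_on_add: "Ck_on k X f \<Longrightarrow> Ck_on k X g \<Longrightarrow> Ck_on k X (\<lambda>x. f x + g x)"
proof (induction k arbitrary: f g)
  case 0
  then show ?case by (auto intro: continuous_intros)
next
  case (Suc k)
  then obtain f' g' where
    "\<forall>x\<in>X. (f has_derivative f' x) (at x within X)" "\<forall>v. Ck_on k X (\<lambda>x. f' x v)"
    "\<forall>x\<in>X. (g has_derivative g' x) (at x within X)" "\<forall>v. Ck_on k X (\<lambda>x. g' x v)"
    by auto
  then show ?case
    by (auto intro!: exI[of _ "\<lambda>x v. f' x v + g' x v"] has_derivative_add Suc.IH)
qed

lemma Ck_on_linear:
  assumes h: "bounded_linear h"
  shows "Ck_on k X f \<Longrightarrow> Ck_on k X (\<lambda>x. h (f x))"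
proof (induction k arbitrary: f)
  case 0
  then show ?case using bounded_linear.continuous_on[OF h] by auto
next
  case (Suc k)
  then obtain f' where
    "\<forall>x\<in>X. (f has_derivative f' x) (at x within X)" "\<forall>v. Ck_on k X (\<lambda>x. f' x v)"
    by auto
  then show ?case
    by (auto intro!: exI[of _ "\<lambda>x v. h (f' x v)"] bounded_linear.has_derivative[OF h] Suc.IH)
qed

text \<open>By the product rule, each directional derivative is a sum of two values of
  \<open>h\<close>. Each pairs a derivative with an undifferentiated factor, and
  \<open>Ck_on_Suc_D\<close> lowers the order of that factor so that the induction hypothesis
  applies.\<close>

lemma Ck_on_bilinear:
  assumes h: "bounded_bilinear h"
  shows "Ck_on k X f \<Longrightarrow> Ck_on k X g \<Longrightarrow> Ck_on k X (\<lambda>x. h (f x) (g x))"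
proof (induction k arbitrary: f g)
  case 0
  then show ?case using bounded_bilinear.continuous_on[OF h] by auto
next
  case (Suc k)
  have fg: "Ck_on k X f" "Ck_on k X g"
    using Suc.prems Ck_on_Suc_D by blast+
  from Suc.prems obtain f' g' where
    "\<forall>x\<in>X. (f has_derivative f' x) (at x within X)" "\<forall>v. Ck_on k X (\<lambda>x. f' x v)"
    "\<forall>x\<in>X. (g has_derivative g' x) (at x within X)" "\<forall>v. Ck_on k X (\<lambda>x. g' x v)"
    by auto
  then show ?case
    using fg
    by (auto intro!: exI[of _ "\<lambda>x v. h (f x) (g' x v) + h (f' x v) (g x)"]
        bounded_bilinear.FDERIV[OF h] Ck_on_add Suc.IH)
qed

text \<open>The linear part \<open>A\<close> is constant, so the derivative along \<open>v\<close>
  is the derivative of \<open>f\<close> in the fixed direction \<open>A v\<close>, composed with the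
  same affine map. Hence the induction closes without products.\<close>

lemma Ck_on_compose_affine:
  assumes "bounded_linear A" "\<And>y. y \<in> Y \<Longrightarrow> c + A y \<in> X"
  shows "Ck_on k X f \<Longrightarrow> Ck_on k Y (\<lambda>y. f (c + A y))"
proof (induction k arbitrary: f)
  case 0
  have "continuous_on Y (\<lambda>y. c + A y)"
    by (intro continuous_intros bounded_linear.continuous_on[OF assms(1)])
  with 0 assms(2) show ?case
    by (auto intro: continuous_on_compose2)
next
  case (Suc k)
  then obtain f' where f':
    "\<And>x. x \<in> X \<Longrightarrow> (f has_derivative f' x) (at x within X)" "\<And>v. Ck_on k X (\<lambda>x. f' x v)"
    by auto
  have "((\<lambda>y. f (c + A y)) has_derivative (\<lambda>v. f' (c + A y) (A v))) (at y within Y)"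
    if "y \<in> Y" for y
  proof (rule has_derivative_in_compose2[of X f f' "\<lambda>y. c + A y" Y y A])
    show "((\<lambda>y. c + A y) has_derivative A) (at y within Y)"
      using bounded_linear_imp_has_derivative[OF assms(1)]
      by (auto intro!: derivative_eq_intros)
  qed (use that assms(2) f' in auto)
  then show ?case
    using Suc.IH[OF f'(2)] by (auto intro!: exI[of _ "\<lambda>y v. f' (c + A y) (A v)"])
qed

lemma smooth_on_cong:
  "smooth_on X f \<Longrightarrow> (\<And>x. x \<in> X \<Longrightarrow> f x = g x) \<Longrightarrow> smooth_on X g"
  unfolding smooth_on_def by (blast intro: Ck_on_cong)

lemma smooth_on_add: "smooth_on X f \<Longrightarrow> smooth_on X g \<Longrightarrow> smooth_on X (\<lambda>x. f x + g x)"
  unfolding smooth_on_def by (blast intro: Ck_on_add)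

lemma smooth_on_linear: "bounded_linear h \<Longrightarrow> smooth_on X f \<Longrightarrow> smooth_on X (\<lambda>x. h (f x))"
  unfolding smooth_on_def by (blast intro: Ck_on_linear)

lemma smooth_on_bilinear:
  "bounded_bilinear h \<Longrightarrow> smooth_on X f \<Longrightarrow> smooth_on X g \<Longrightarrow> smooth_on X (\<lambda>x. h (f x) (g x))"
  unfolding smooth_on_def by (blast intro: Ck_on_bilinear)

lemma smooth_on_continuous: "smooth_on X f \<Longrightarrow> continuous_on X f"
  unfolding smooth_on_def by (metis Ck_on.simps(1))

section \<open>Skew matrices and the cross product\<close>

lemma bounded_bilinear_matrix_mult:
  "bounded_bilinear ((**) :: real^'n^'m \<Rightarrow> real^'p^'n \<Rightarrow> real^'p^'m)"
  unfolding bilinear_conv_bounded_bilinear[symmetric] bilinear_def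
  by (auto intro!: linearI simp: matrix_matrix_mult_def vec_eq_iff
      sum.distrib distrib_left distrib_right sum_distrib_left ac_simps)

lemma bounded_bilinear_matrix_vector_mult:
  "bounded_bilinear ((*v) :: real^'n^'m \<Rightarrow> real^'n \<Rightarrow> real^'m)"
  unfolding bilinear_conv_bounded_bilinear[symmetric] bilinear_def
  by (auto intro!: linearI simp: matrix_vector_mult_def vec_eq_iff
      sum.distrib distrib_left distrib_right sum_distrib_left ac_simps)

lemma bounded_linear_transpose: "bounded_linear (transpose :: real^'n^'m \<Rightarrow> real^'m^'n)"
  by (rule linear_conv_bounded_linear[THEN iffD1])
    (auto intro!: linearI simp: transpose_def vec_eq_iff)

lemma bounded_bilinear_cross3: "bounded_bilinear cross3"
  using bilinear_cross bilinear_conv_bounded_bilinear by blast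

definition hat :: "real^3 \<Rightarrow> real^3^3" where
  "hat a = (\<chi> i k. cross3 a (axis k 1) $ i)"

text \<open>The axial vector of the skew part of \<open>M\<close>. It is linear on all matrices, so
  smoothness passes through it, and it replaces the definite description in \<open>j_map\<close> on
  \<open>so3\<close>.\<close>

definition axial :: "real^3^3 \<Rightarrow> real^3" where
  "axial M = (1/2) *\<^sub>R vector [M$3$2 - M$2$3, M$1$3 - M$3$1, M$2$1 - M$1$2]"

lemma hat_mult_vector: "hat a *v x = cross3 a x"
  by (simp add: hat_def matrix_vector_mult_def cross3_def vec_eq_iff sum_3 axis_def forall_3)

lemma hat_in_so3: "hat a \<in> so3"
  by (simp add: so3_def hat_def transpose_def cross3_def vec_eq_iff axis_def forall_3)

lemma axial_cross:
  assumes "M \<in> so3"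
  shows "M *v x = cross3 (axial M) x"
proof -
  have "M $ i $ k = - M $ k $ i" for i k
  proof -
    have "transpose M $ k $ i = (- M) $ k $ i"
      using assms by (simp only: so3_def mem_Collect_eq)
    then show ?thesis by (simp only: transpose_def vec_lambda_beta vector_uminus_component)
  qed
  from this[of 1 1] this[of 2 2] this[of 3 3] this[of 1 2] this[of 1 3] this[of 2 3]
  have "M$1$1 = 0" "M$2$2 = 0" "M$3$3 = 0" "M$1$2 = - M$2$1" "M$1$3 = - M$3$1" "M$2$3 = - M$3$2"
    by linarith+
  then show ?thesis
    by (simp add: axial_def matrix_vector_mult_def cross3_def vec_eq_iff sum_3 forall_3)
qed

text \<open>Two basis vectors suffice: the first detects components 2 and 3, the second components 1
  and 3.\<close>

lemma cross3_eqI: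
  assumes "\<And>x. cross3 a x = cross3 b x"
  shows "a = b"
  using assms[of "axis 1 1"] assms[of "axis 2 1"]
  by (simp add: cross3_def vec_eq_iff forall_3 axis_def)

text \<open>The Jacobi identity, in the form that \<open>hat\<close> turns the cross product into
  the commutator of matrices.\<close>

lemma cross3_commutator:
  "cross3 a (cross3 b x) - cross3 b (cross3 a x) = cross3 (cross3 a b) x"
  by (simp add: cross3_def vec_eq_iff forall_3 algebra_simps)

lemma j_map_eqI: "(\<And>x. M *v x = cross3 a x) \<Longrightarrow> j_map M = a"
  unfolding j_map_def by (rule the_equality) (auto intro: cross3_eqI)

lemma j_map_so3: "M \<in> so3 \<Longrightarrow> j_map M = axial M"
  by (simp add: j_map_eqI axial_cross)

text \<open>A skew matrix is determined by its action, hence by its axial vector; so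
  \<open>j_map\<close> is injective on \<open>so3\<close> and \<open>hat\<close> provides the
  preimages.\<close>

lemma j_inv_eq_hat: "j_inv a = hat a"
proof -
  have "inj_on j_map so3"
    by (rule inj_onI) (metis axial_cross j_map_so3 matrix_eq)
  moreover have "j_map (hat a) = a"
    by (rule j_map_eqI) (rule hat_mult_vector)
  ultimately show ?thesis
    unfolding j_inv_def using hat_in_so3 by (metis the_inv_into_f_f)
qed

lemma bounded_linear_axial: "bounded_linear axial"
  by (rule linear_conv_bounded_linear[THEN iffD1])
    (auto intro!: linearI simp: axial_def vec_eq_iff forall_3 field_simps)

text \<open>Uniqueness of two-sided inverses pins down the choice made by \<open>matrix_inv\<close>.
  The transpose is linear, so it can be differentiated directly.\<close>

lemma rotation_matrix_inverse:
  assumes "rotation_matrix Q"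
  shows "matrix_inv Q = transpose Q" "transpose Q ** Q = mat 1" "Q ** transpose Q = mat 1"
proof -
  show *: "transpose Q ** Q = mat 1" "Q ** transpose Q = mat 1"
    using assms by (auto simp: rotation_matrix_def orthogonal_matrix_def)
  then show "matrix_inv Q = transpose Q"
    unfolding matrix_inv_def
    by (intro some_equality) (auto, metis matrix_mul_assoc matrix_mul_lid matrix_mul_rid)
qed

section \<open>Smooth fields on a space-time strip\<close>

locale strip =
  fixes L :: real and T :: "real set"
  assumes L_pos: "L > 0"
    and convex_T: "convex T"
    and T_nontrivial: "\<And>t. \<exists>c\<in>T. c \<noteq> t"
begin

abbreviation smooth_field :: "(real \<Rightarrow> real \<Rightarrow> 'b::real_normed_vector) \<Rightarrow> bool" where
  "smooth_field F \<equiv> smooth_on ({0..L} \<times> T) (case_prod F)"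

section \<open>Uniqueness of one-sided derivatives, and smoothness of partial derivatives\<close>

lemma time_not_isolated: "t \<in> T \<Longrightarrow> at t within T \<noteq> bot"
proof -
  assume t: "t \<in> T"
  obtain c where "c \<in> T" "c \<noteq> t" using T_nontrivial by blast
  then show ?thesis
    using t convex_T connected_imp_perfect[of T t] convex_connected[of T]
    by (auto simp: trivial_limit_within)
qed

lemma space_not_isolated: "S \<in> {0..L} \<Longrightarrow> at S within {0..L} \<noteq> bot"
  using L_pos by (metis islimpt_Icc trivial_limit_within)

text \<open>Chain rule along the insertions of one variable. They stay inside the strip, so boundary
  points are covered, and linearity of \<open>f' (S, t)\<close> turns the result into a vector
  derivative.\<close>

lemma partial_derivatives:
  assumes "\<forall>x\<in>{0..L} \<times> T. (case_prod F has_derivative f' x) (at x within {0..L} \<times> T)"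
    and S: "S \<in> {0..L}" and t: "t \<in> T"
  shows "((\<lambda>s. F s t) has_vector_derivative f' (S, t) (1, 0)) (at S within {0..L})"
    and "((\<lambda>\<tau>. F S \<tau>) has_vector_derivative f' (S, t) (0, 1)) (at t within T)"
proof -
  have D: "(case_prod F has_derivative f' (S, t)) (at (S, t) within {0..L} \<times> T)"
    using assms by auto
  then have lin: "linear (f' (S, t))"
    by (rule has_derivative_linear)
  have "((\<lambda>s. case_prod F (s, t)) has_derivative (\<lambda>h. f' (S, t) (h, 0))) (at S within {0..L})"
    by (rule has_derivative_in_compose2[of "{0..L} \<times> T" "case_prod F" f' "\<lambda>s. (s, t)"])
      (use assms(1) in blast, use S t in \<open>auto intro!: derivative_eq_intros\<close>)
  moreover have "(\<lambda>h. f' (S, t) (h, 0)) = (\<lambda>h. h *\<^sub>R f' (S, t) (1, 0))"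
    using linear_scale[OF lin, of _ "(1, 0)"]
    by (intro ext) (metis mult.right_neutral scaleR_Pair scaleR_zero_right real_scaleR_def)
  ultimately show "((\<lambda>s. F s t) has_vector_derivative f' (S, t) (1, 0)) (at S within {0..L})"
    unfolding has_vector_derivative_def prod.case by metis
  have "((\<lambda>\<tau>. case_prod F (S, \<tau>)) has_derivative (\<lambda>h. f' (S, t) (0, h))) (at t within T)"
    by (rule has_derivative_in_compose2[of "{0..L} \<times> T" "case_prod F" f' "\<lambda>\<tau>. (S, \<tau>)"])
      (use assms(1) in blast, use S t in \<open>auto intro!: derivative_eq_intros\<close>)
  moreover have "(\<lambda>h. f' (S, t) (0, h)) = (\<lambda>h. h *\<^sub>R f' (S, t) (0, 1))"
    using linear_scale[OF lin, of _ "(0, 1)"]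
    by (intro ext) (metis mult.right_neutral scaleR_Pair scaleR_zero_right real_scaleR_def)
  ultimately show "((\<lambda>\<tau>. F S \<tau>) has_vector_derivative f' (S, t) (0, 1)) (at t within T)"
    unfolding has_vector_derivative_def prod.case by metis
qed

lemma dS_eq:
  "S \<in> {0..L} \<Longrightarrow> ((\<lambda>s. F s t) has_vector_derivative d) (at S within {0..L}) \<Longrightarrow> dS L F S t = d"
  unfolding dS_def by (rule vector_derivative_within[OF space_not_isolated])

lemma dt_eq:
  "t \<in> T \<Longrightarrow> ((\<lambda>\<tau>. F S \<tau>) has_vector_derivative d) (at t within T) \<Longrightarrow> dt T F S t = d"
  unfolding dt_def by (rule vector_derivative_within[OF time_not_isolated])

text \<open>The derivative witnessing smoothness may vary with the order \<open>k\<close>, but its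
  values on \<open>(1, 0)\<close> and \<open>(0, 1)\<close> are forced to be \<open>dS\<close> and
  \<open>dt\<close> by uniqueness. Thus one and the same function is \<open>Ck_on\<close> for every
  \<open>k\<close>.\<close>

lemma smooth_field_partials:
  assumes F: "smooth_field F"
  shows "smooth_field (dS L F)" and "smooth_field (dt T F)"
    and "S \<in> {0..L} \<Longrightarrow> t \<in> T \<Longrightarrow>
      ((\<lambda>s. F s t) has_vector_derivative dS L F S t) (at S within {0..L})"
    and "S \<in> {0..L} \<Longrightarrow> t \<in> T \<Longrightarrow>
      ((\<lambda>\<tau>. F S \<tau>) has_vector_derivative dt T F S t) (at t within T)"
proof -
  have *: "\<exists>f'. (\<forall>x\<in>{0..L} \<times> T. (case_prod F has_derivative f' x) (at x within {0..L} \<times> T))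
      \<and> (\<forall>v. Ck_on k ({0..L} \<times> T) (\<lambda>x. f' x v))" for k
    using F Ck_on.simps(2) unfolding smooth_on_def by blast
  have "Ck_on k ({0..L} \<times> T) (case_prod (dS L F)) \<and> Ck_on k ({0..L} \<times> T) (case_prod (dt T F))" for k
  proof -
    obtain f' where f': "\<forall>x\<in>{0..L} \<times> T. (case_prod F has_derivative f' x) (at x within {0..L} \<times> T)"
      "\<And>v. Ck_on k ({0..L} \<times> T) (\<lambda>x. f' x v)"
      using *[of k] by blast
    show ?thesis
      using Ck_on_cong[OF f'(2)[of "(1, 0)"], of "case_prod (dS L F)"]
        Ck_on_cong[OF f'(2)[of "(0, 1)"], of "case_prod (dt T F)"]
        dS_eq[OF _ partial_derivatives(1)[OF f'(1)]] dt_eq[OF _ partial_derivatives(2)[OF f'(1)]]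
      by auto
  qed
  then show "smooth_field (dS L F)" "smooth_field (dt T F)"
    unfolding smooth_on_def by blast+
  obtain f' where f': "\<forall>x\<in>{0..L} \<times> T. (case_prod F has_derivative f' x) (at x within {0..L} \<times> T)"
    using *[of 0] by blast
  show "((\<lambda>s. F s t) has_vector_derivative dS L F S t) (at S within {0..L})"
    if "S \<in> {0..L}" "t \<in> T"
    using partial_derivatives(1)[OF f' that] dS_eq[OF that(1)] by metis
  show "((\<lambda>\<tau>. F S \<tau>) has_vector_derivative dt T F S t) (at t within T)"
    if "S \<in> {0..L}" "t \<in> T"
    using partial_derivatives(2)[OF f' that] dt_eq[OF that(2)] by metis
qed

lemmas smooth_field_dS = smooth_field_partials(1)
  and smooth_field_dt = smooth_field_partials(2)
  and has_dS = smooth_field_partials(3)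
  and has_dt = smooth_field_partials(4)

lemma smooth_field_slice:
  assumes "smooth_field F" "t \<in> T"
  shows "smooth_on {0..L} (\<lambda>s. F s t)"
proof -
  have "Ck_on k {0..L} (\<lambda>s. case_prod F ((0, t) + (s, 0)))" for k
    by (rule Ck_on_compose_affine[of "\<lambda>s. (s, 0)" _ _ "{0..L} \<times> T"])
      (use assms in \<open>auto simp: smooth_on_def intro!: bounded_linear_Pair bounded_linear_zero bounded_linear_ident\<close>)
  then show ?thesis by (simp add: smooth_on_def)
qed

text \<open>Supplies a compact interval for the fundamental theorem of calculus; \<open>t\<close> is
  one of its end points, so it may also be an end point of \<open>T\<close>.\<close>

lemma time_interval:
  assumes "t \<in> T"
  obtains a b where "a < b" "t \<in> {a..b}" "{a..b} \<subseteq> T"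
proof -
  obtain c where c: "c \<in> T" "c \<noteq> t" using T_nontrivial by blast
  have "closed_segment (min c t) (max c t) \<subseteq> T"
    using assms c convex_T by (intro closed_segment_subset) (auto simp: min_def max_def)
  moreover have "min c t < max c t" using c(2) by linarith
  ultimately show ?thesis
    using that[of "min c t" "max c t"] by (simp add: closed_segment_eq_real_ivl)
qed

text \<open>Differentiating \<open>F S \<tau> = F S a + \<integral>\<^sub>a\<^sup>\<tau> \<partial>\<^sub>t F S\<close> under the integral
  also gives the boundary case, where the usual symmetry theorem does not apply.\<close>

lemma dt_dS_commute:
  fixes F :: "real \<Rightarrow> real \<Rightarrow> 'b::banach"
  assumes F: "smooth_field F" and S: "S \<in> {0..L}" and t: "t \<in> T"
  shows "dt T (dS L F) S t = dS L (dt T F) S t"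
proof -
  obtain a b where ab: "a < b" "t \<in> {a..b}" "{a..b} \<subseteq> T"
    using time_interval[OF t] .
  note Ft = smooth_field_dt[OF F]
  note FtS = smooth_field_dS[OF Ft]
  have cont: "continuous_on {a..b} (\<lambda>\<tau>. G s \<tau>)"
    if "smooth_field G" "s \<in> {0..L}" for G :: "real \<Rightarrow> real \<Rightarrow> 'b" and s
  proof -
    have "continuous_on {a..b} (\<lambda>\<tau>. case_prod G (s, \<tau>))"
      by (rule continuous_on_compose2[OF smooth_on_continuous[OF that(1)]])
        (use that ab in \<open>auto intro!: continuous_intros\<close>)
    then show ?thesis by simp
  qed
  have FTC: "F s \<tau> = F s a + integral {a..\<tau>} (dt T F s)" if "s \<in> {0..L}" "\<tau> \<in> {a..b}" for s \<tau>
  proof -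
    have "(dt T F s has_integral F s \<tau> - F s a) {a..\<tau>}"
      using that ab
      by (intro fundamental_theorem_of_calculus)
        (auto intro!: has_vector_derivative_within_subset[OF has_dt[OF F]])
    then show ?thesis by (simp add: integral_unique)
  qed
  have dSF: "dS L F S \<tau> = dS L F S a + integral {a..\<tau>} (dS L (dt T F) S)" if "\<tau> \<in> {a..b}" for \<tau>
  proof (rule dS_eq[OF S])
    have sub: "{a..\<tau>} \<subseteq> {a..b}" using that by auto
    \<comment> \<open>Joint continuity of the mixed derivative on the rectangle justifies
      differentiating under the integral.\<close>
    have "((\<lambda>s. integral (cbox a \<tau>) (dt T F s)) has_vector_derivative
        integral (cbox a \<tau>) (dS L (dt T F) S)) (at S within {0..L})"
    proof (rule leibniz_rule_vector_derivative)
      show "((\<lambda>s. dt T F s r) has_vector_derivative dS L (dt T F) s r) (at s within {0..L})"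
        if "s \<in> {0..L}" "r \<in> cbox a \<tau>" for s r
        using that ab sub by (intro has_dS[OF Ft]) auto
      show "dt T F s integrable_on cbox a \<tau>" if "s \<in> {0..L}" for s
        using continuous_on_subset[OF cont[OF Ft that] sub]
        by (auto intro: integrable_continuous_real)
      show "continuous_on ({0..L} \<times> cbox a \<tau>) (\<lambda>(s, r). dS L (dt T F) s r)"
        using sub ab by (intro continuous_on_subset[OF smooth_on_continuous[OF FtS]]) auto
    qed (use S in auto)
    moreover have "((\<lambda>s. F s a) has_vector_derivative dS L F S a) (at S within {0..L})"
      using ab by (intro has_dS[OF F S]) auto
    ultimately have "((\<lambda>s. F s a + integral {a..\<tau>} (dt T F s)) has_vector_derivative
        dS L F S a + integral {a..\<tau>} (dS L (dt T F) S)) (at S within {0..L})"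
      by (auto intro: has_vector_derivative_add)
    then show "((\<lambda>s. F s \<tau>) has_vector_derivative
        dS L F S a + integral {a..\<tau>} (dS L (dt T F) S)) (at S within {0..L})"
      by (rule has_vector_derivative_transform[OF S, rotated]) (rule FTC[OF _ that])
  qed
  \<comment> \<open>Now \<open>dSF\<close> is differentiated in its upper limit, which recovers the
    integrand at \<open>t\<close>.\<close>
  have "((\<lambda>\<tau>. dS L F S a + integral {a..\<tau>} (dS L (dt T F) S)) has_vector_derivative
      0 + dS L (dt T F) S t) (at t within {a..b})"
    by (intro has_vector_derivative_add has_vector_derivative_const
        integral_has_vector_derivative cont[OF FtS S] ab)
  then have "((\<lambda>\<tau>. dS L F S \<tau>) has_vector_derivative dS L (dt T F) S t) (at t within {a..b})"
    unfolding add_0_left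
    by (rule has_vector_derivative_transform[OF ab(2), rotated]) (rule dSF)
  \<comment> \<open>The derivative within \<open>T\<close> restricts to \<open>{a..b}\<close>, where
    it must agree with the one just computed.\<close>
  moreover have "((\<lambda>\<tau>. dS L F S \<tau>) has_vector_derivative dt T (dS L F) S t) (at t within {a..b})"
    using has_dt[OF smooth_field_dS[OF F] S t] ab(3) by (rule has_vector_derivative_within_subset)
  moreover have "at t within {a..b} \<noteq> bot"
    using ab by (metis islimpt_Icc trivial_limit_within)
  ultimately show ?thesis
    by (metis vector_derivative_within)
qed

lemma smooth_field_dS_funpow:
  "smooth_field F \<Longrightarrow> smooth_field ((dS L ^^ i) F)"
  by (induction i) (auto intro: smooth_field_dS)

lemma dS_cong:
  assumes "S \<in> {0..L}" "\<And>s. s \<in> {0..L} \<Longrightarrow> F s t = G s t"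
  shows "dS L F S t = dS L G S t"
proof -
  have "eventually (\<lambda>s. F s t = G s t) (at S within {0..L})"
    using assms by (auto simp: eventually_at_filter)
  then show ?thesis
    unfolding dS_def using assms by (intro vector_derivative_cong_eq) auto
qed

lemma dt_dS_funpow_commute:
  fixes F :: "real \<Rightarrow> real \<Rightarrow> 'b::banach"
  assumes F: "smooth_field F" and "S \<in> {0..L}" and t: "t \<in> T"
  shows "dt T ((dS L ^^ i) F) S t = (dS L ^^ i) (dt T F) S t"
  using assms(2)
proof (induction i arbitrary: S)
  case (Suc i)
  have "dt T (dS L ((dS L ^^ i) F)) S t = dS L (dt T ((dS L ^^ i) F)) S t"
    by (rule dt_dS_commute[OF smooth_field_dS_funpow[OF F] Suc.prems t])
  also have "\<dots> = dS L ((dS L ^^ i) (dt T F)) S t"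
    by (rule dS_cong) (use Suc in auto)
  finally show ?case by simp
qed simp

text \<open>Compactness of \<open>{0..L}\<close> makes the continuity of \<open>dt T F\<close> at
  time \<open>t\<close> uniform in \<open>S\<close>; a mean value estimate in time then bounds the
  linearization error.\<close>

lemma uniform_time_derivative:
  fixes F :: "real \<Rightarrow> real \<Rightarrow> 'b::real_normed_vector"
  assumes F: "smooth_field F" and t: "t \<in> T" and e: "e > 0"
  shows "\<forall>\<^sub>F \<tau> in at t within T. \<forall>S\<in>{0..L}.
    norm (F S \<tau> - F S t - (\<tau> - t) *\<^sub>R dt T F S t) \<le> e * \<bar>\<tau> - t\<bar>"
proof -
  \<comment> \<open>The variables are swapped so that the compact factor comes second, as
    \<open>continuous_on_prod_compactE\<close> expects.\<close>
  have "continuous_on (T \<times> {0..L}) (\<lambda>x. case_prod (dt T F) (snd x, fst x))"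
    by (rule continuous_on_compose2[OF smooth_on_continuous[OF smooth_field_dt[OF F]]])
      (auto intro!: continuous_intros)
  from continuous_on_prod_compactE[OF this compact_Icc t e]
  obtain U where U: "t \<in> U" "open U"
    "\<forall>\<tau>\<in>U \<inter> T. \<forall>S\<in>{0..L}. dist (dt T F S \<tau>) (dt T F S t) \<le> e"
    unfolding prod.case fst_conv snd_conv .
  obtain r where r: "r > 0" "ball t r \<subseteq> U" using openE[OF U(2,1)] by blast
  define V where "V = T \<inter> ball t r"
  have "norm (F S \<tau> - F S t - (\<tau> - t) *\<^sub>R dt T F S t) \<le> e * \<bar>\<tau> - t\<bar>"
    if "\<tau> \<in> V" "S \<in> {0..L}" for S \<tau>
  proof -
    have "norm (F S \<tau> - F S t - (\<tau> - t) *\<^sub>R dt T F S t) \<le> norm (\<tau> - t) * e"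
    proof (rule vector_differentiable_bound_linearization)
      show "((\<lambda>\<tau>. F S \<tau>) has_vector_derivative dt T F S x) (at x within V)" if "x \<in> V" for x
        using that \<open>S \<in> {0..L}\<close>
        by (intro has_vector_derivative_within_subset[OF has_dt[OF F]]) (auto simp: V_def)
      show "closed_segment t \<tau> \<subseteq> V"
        using that t r convex_T by (intro closed_segment_subset) (auto simp: V_def convex_Int)
      show "norm (dt T F S x - dt T F S t) \<le> e" if "x \<in> V" for x
        using bspec[OF bspec[OF U(3)], of x S] r that \<open>S \<in> {0..L}\<close>
        by (auto simp: V_def dist_norm)
    qed (use t r in \<open>auto simp: V_def\<close>)
    then show ?thesis by (simp add: mult.commute)
  qed
  moreover have "\<forall>\<^sub>F \<tau> in at t within T. \<tau> \<in> V"
    using eventually_at_ball'[OF r(1), of t T] by eventually_elim (simp add: V_def)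
  ultimately show ?thesis
    by (auto elim: eventually_mono)
qed

lemma dS_funpow_eq:
  "(dS L ^^ i) F S t = ((\<lambda>u s. vector_derivative u (at s within {0..L})) ^^ i) (\<lambda>s. F s t) S"
proof (induction i arbitrary: S)
  case (Suc i)
  then show ?case by (simp add: dS_def)
qed simp

text \<open>Three terms are what the first-order remainder in time consists of: the new value, the
  old value and the linear part.\<close>

lemma dS_funpow_combination:
  assumes U: "smooth_field U" and V: "smooth_field V" and W: "smooth_field W"
    and "S \<in> {0..L}" and t: "t \<in> T"
  shows "(dS L ^^ i) (\<lambda>s \<tau>. a *\<^sub>R U s \<tau> + b *\<^sub>R V s \<tau> + c *\<^sub>R W s \<tau>) S t =
    a *\<^sub>R (dS L ^^ i) U S t + b *\<^sub>R (dS L ^^ i) V S t + c *\<^sub>R (dS L ^^ i) W S t"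
  using assms(4)
proof (induction i arbitrary: S)
  case (Suc i)
  have D: "((\<lambda>s. q *\<^sub>R (dS L ^^ i) G s t) has_vector_derivative q *\<^sub>R (dS L ^^ Suc i) G S t)
      (at S within {0..L})" if "smooth_field G" for G :: "real \<Rightarrow> real \<Rightarrow> 'a" and q
    using has_dS[OF smooth_field_dS_funpow[OF that] Suc.prems t]
    by (simp add: bounded_linear.has_vector_derivative[OF bounded_linear_scaleR_right])
  have "(dS L ^^ Suc i) (\<lambda>s \<tau>. a *\<^sub>R U s \<tau> + b *\<^sub>R V s \<tau> + c *\<^sub>R W s \<tau>) S t =
      dS L (\<lambda>s t. a *\<^sub>R (dS L ^^ i) U s t + b *\<^sub>R (dS L ^^ i) V s t + c *\<^sub>R (dS L ^^ i) W s t) S t"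
    unfolding funpow.simps comp_apply by (rule dS_cong) (use Suc in auto)
  also have "\<dots> = a *\<^sub>R (dS L ^^ Suc i) U S t + b *\<^sub>R (dS L ^^ Suc i) V S t + c *\<^sub>R (dS L ^^ Suc i) W S t"
    by (intro dS_eq[OF Suc.prems] has_vector_derivative_add D U V W)
  finally show ?case .
qed simp

text \<open>Turns the field at a single time into a field on the strip that is constant in time, so
  that the lemmas on \<open>dS\<close> apply to remainders mixing two times.\<close>

lemma smooth_field_frozen:
  assumes "smooth_field F" "t \<in> T"
  shows "smooth_field (\<lambda>s _. F s t)"
proof -
  have "Ck_on k ({0..L} \<times> T) (\<lambda>x. case_prod F ((0, t) + (fst x, 0)))" for k
    by (rule Ck_on_compose_affine[of "\<lambda>x. (fst x, 0)" _ _ "{0..L} \<times> T"])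
      (use assms in \<open>auto simp: smooth_on_def intro!: bounded_linear_Pair bounded_linear_zero bounded_linear_fst\<close>)
  then show ?thesis by (simp add: smooth_on_def case_prod_unfold)
qed

text \<open>The argument \<open>t\<close> is a dummy, as the field ignores time. The uniform bound
  also makes the suprema meaningful for nonnegativity, and \<open>k + 1\<close> counts the orders
  \<open>0\<close> to \<open>k\<close>.\<close>

lemma Ck_norm_bounds:
  fixes h :: "real \<Rightarrow> 'b::real_normed_vector" and b :: real
  assumes "\<And>i S. i \<le> k \<Longrightarrow> S \<in> {0..L} \<Longrightarrow> norm ((dS L ^^ i) (\<lambda>s _. h s) S t) \<le> b"
  shows "0 \<le> Ck_norm k L h" and "Ck_norm k L h \<le> (real k + 1) * b"
proof -
  let ?D = "\<lambda>i S. norm (((\<lambda>u s. vector_derivative u (at s within {0..L})) ^^ i) h S)"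
  have D: "?D i S \<le> b" if "i \<le> k" "S \<in> {0..L}" for i S
    using assms[OF that] by (simp add: dS_funpow_eq)
  have "0 \<le> (SUP S\<in>{0..L}. ?D i S)" if "i \<le> k" for i
    using L_pos D[OF that] by (intro cSUP_upper2[where x = 0]) (auto intro!: bdd_aboveI2[where M = b])
  then show "0 \<le> Ck_norm k L h"
    unfolding Ck_norm_def by (auto intro: sum_nonneg)
  have "Ck_norm k L h \<le> (\<Sum>i\<le>k. b)"
    unfolding Ck_norm_def using L_pos D by (intro sum_mono cSUP_least) auto
  then show "Ck_norm k L h \<le> (real k + 1) * b" by (simp add: add.commute)
qed

text \<open>Since \<open>dt\<close> commutes with iterated \<open>dS\<close>, the space derivatives
  of the remainder are the time remainders of the space derivatives.
  \<open>uniform_time_derivative\<close> applies to each of the finitely many orders.\<close>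

lemma Ck_norm_time_increment:
  fixes F :: "real \<Rightarrow> real \<Rightarrow> 'b::banach"
  assumes F: "smooth_field F" and t: "t \<in> T"
  obtains M where "M > 0"
    and "\<And>e. e > 0 \<Longrightarrow> \<forall>\<^sub>F \<tau> in at t within T.
      0 \<le> Ck_norm k L (\<lambda>s. F s \<tau> - F s t - (\<tau> - t) *\<^sub>R dt T F s t) \<and>
      Ck_norm k L (\<lambda>s. F s \<tau> - F s t - (\<tau> - t) *\<^sub>R dt T F s t) \<le> e * \<bar>\<tau> - t\<bar>"
    and "\<forall>\<^sub>F \<tau> in at t within T. 0 \<le> Ck_norm k L (\<lambda>s. F s \<tau> - F s t) \<and>
      Ck_norm k L (\<lambda>s. F s \<tau> - F s t) \<le> M * \<bar>\<tau> - t\<bar>"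
proof -
  note Fi = smooth_field_dS_funpow[OF F]
  note Ft = smooth_field_dt[OF F]
  have "bounded ((\<lambda>S. dt T ((dS L ^^ i) F) S t) ` {0..L})" for i
    using smooth_field_slice[OF smooth_field_dt[OF Fi] t]
    by (intro compact_imp_bounded compact_continuous_image smooth_on_continuous) auto
  then have "bounded (\<Union>i\<in>{..k}. (\<lambda>S. dt T ((dS L ^^ i) F) S t) ` {0..L})"
    by (intro bounded_UN) auto
  then obtain B where "\<forall>x\<in>(\<Union>i\<in>{..k}. (\<lambda>S. dt T ((dS L ^^ i) F) S t) ` {0..L}). norm x \<le> B"
    unfolding bounded_iff ..
  then have B: "norm (dt T ((dS L ^^ i) F) S t) \<le> B" if "i \<le> k" "S \<in> {0..L}" for i S
    using that by auto
  have comb: "(dS L ^^ i) (\<lambda>s _. F s \<tau> - F s t - q *\<^sub>R dt T F s t) S t =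
      (dS L ^^ i) F S \<tau> - (dS L ^^ i) F S t - q *\<^sub>R dt T ((dS L ^^ i) F) S t"
    if "\<tau> \<in> T" "S \<in> {0..L}" for i \<tau> q S
    using dS_funpow_combination[OF smooth_field_frozen[OF F that(1)] smooth_field_frozen[OF F t]
        smooth_field_frozen[OF Ft t] that(2) t, of i 1 "-1" "- q"]
      dt_dS_funpow_commute[OF F that(2) t, of i]
    by (simp add: dS_funpow_eq)
  have ev: "\<forall>\<^sub>F \<tau> in at t within T. \<tau> \<in> T \<and> (\<forall>i\<in>{..k}. \<forall>S\<in>{0..L}.
      norm ((dS L ^^ i) F S \<tau> - (dS L ^^ i) F S t - (\<tau> - t) *\<^sub>R dt T ((dS L ^^ i) F) S t)
        \<le> e * \<bar>\<tau> - t\<bar>)" if "e > 0" for e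
    using uniform_time_derivative[OF Fi t that]
    by (intro eventually_conj eventually_ball_finite) (auto simp: eventually_at_filter)
  show thesis
  proof
    show "\<forall>\<^sub>F \<tau> in at t within T.
      0 \<le> Ck_norm k L (\<lambda>s. F s \<tau> - F s t - (\<tau> - t) *\<^sub>R dt T F s t) \<and>
      Ck_norm k L (\<lambda>s. F s \<tau> - F s t - (\<tau> - t) *\<^sub>R dt T F s t) \<le> e * \<bar>\<tau> - t\<bar>" if "e > 0" for e
    proof -
      \<comment> \<open>The division compensates for the \<open>k + 1\<close> summands of the
        norm.\<close>
      have "e / (real k + 1) > 0" using that by simp
      from ev[OF this] show ?thesis
      proof eventually_elim
        case (elim \<tau>)
        then have "norm ((dS L ^^ i) (\<lambda>s _. F s \<tau> - F s t - (\<tau> - t) *\<^sub>R dt T F s t) S t)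
            \<le> e / (real k + 1) * \<bar>\<tau> - t\<bar>" if "i \<le> k" "S \<in> {0..L}" for i S
          using that by (simp add: comb)
        from Ck_norm_bounds[where k = k, OF this] show ?case by simp
      qed
    qed
    \<comment> \<open>Per order, \<open>1\<close> bounds the remainder taken with tolerance one and
      \<open>\<bar>B\<bar>\<close> the linear part.\<close>
    let ?M = "(real k + 1) * (1 + \<bar>B\<bar>)"
    show "?M > 0" by (intro mult_pos_pos) auto
    show "\<forall>\<^sub>F \<tau> in at t within T. 0 \<le> Ck_norm k L (\<lambda>s. F s \<tau> - F s t) \<and>
      Ck_norm k L (\<lambda>s. F s \<tau> - F s t) \<le> ?M * \<bar>\<tau> - t\<bar>"
      using ev[OF zero_less_one]
    proof eventually_elim
      case (elim \<tau>)
      have "norm ((dS L ^^ i) (\<lambda>s _. F s \<tau> - F s t) S t) \<le> (1 + \<bar>B\<bar>) * \<bar>\<tau> - t\<bar>"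
        if "i \<le> k" "S \<in> {0..L}" for i S
      proof -
        \<comment> \<open>With \<open>q = 0\<close> the linear term drops out of
          \<open>comb\<close>.\<close>
        have eq: "(dS L ^^ i) (\<lambda>s _. F s \<tau> - F s t) S t = (dS L ^^ i) F S \<tau> - (dS L ^^ i) F S t"
          using comb[of \<tau> S i 0] elim that by simp
        have "norm ((dS L ^^ i) F S \<tau> - (dS L ^^ i) F S t) \<le>
            norm ((dS L ^^ i) F S \<tau> - (dS L ^^ i) F S t - (\<tau> - t) *\<^sub>R dt T ((dS L ^^ i) F) S t)
            + norm ((\<tau> - t) *\<^sub>R dt T ((dS L ^^ i) F) S t)"
          by (metis diff_add_cancel norm_triangle_ineq)
        also have "\<dots> \<le> 1 * \<bar>\<tau> - t\<bar> + \<bar>\<tau> - t\<bar> * \<bar>B\<bar>"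
        proof (rule add_mono)
          show "norm ((dS L ^^ i) F S \<tau> - (dS L ^^ i) F S t - (\<tau> - t) *\<^sub>R dt T ((dS L ^^ i) F) S t)
              \<le> 1 * \<bar>\<tau> - t\<bar>"
            using bspec[OF bspec[OF conjunct2[OF elim]], of i S] that by simp
          have "norm (dt T ((dS L ^^ i) F) S t) \<le> \<bar>B\<bar>"
            using B[OF that] by linarith
          then show "norm ((\<tau> - t) *\<^sub>R dt T ((dS L ^^ i) F) S t) \<le> \<bar>\<tau> - t\<bar> * \<bar>B\<bar>"
            by (simp add: mult_left_mono)
        qed
        also have "\<dots> = (1 + \<bar>B\<bar>) * \<bar>\<tau> - t\<bar>"
          by (simp add: algebra_simps)
        finally show ?thesis
          unfolding eq .
      qed
      then show ?case
        using Ck_norm_bounds[of k "\<lambda>s. F s \<tau> - F s t" t "(1 + \<bar>B\<bar>) * \<bar>\<tau> - t\<bar>"]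
        by (simp add: mult.assoc)
    qed
  qed
qed

text \<open>The increment \<open>?h\<close> is the remainder \<open>?r\<close> plus
  \<open>\<tau> - t\<close> times \<open>?w\<close>. The Frechet error is small relative to the norm
  of \<open>?h\<close>, which is of order \<open>\<bar>\<tau> - t\<bar>\<close>, and boundedness of
  \<open>df\<close> makes \<open>df ?r\<close> of smaller order.\<close>

lemma functional_chain_rule:
  assumes F: "smooth_field F" and t: "t \<in> T"
    and f: "has_functional_derivative L f df (\<lambda>s. F s t)"
  shows "((\<lambda>\<tau>. f (\<lambda>s. F s \<tau>)) has_real_derivative df (\<lambda>s. dt T F s t)) (at t within T)"
proof -
  let ?h = "\<lambda>\<tau> s. F s \<tau> - F s t"
  let ?w = "\<lambda>s. dt T F s t"
  let ?r = "\<lambda>\<tau> s. F s \<tau> - F s t - (\<tau> - t) *\<^sub>R dt T F s t"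
  note f = f[unfolded has_functional_derivative_def]
  have add: "df (\<lambda>S. h1 S + h2 S) = df h1 + df h2"
    if "smooth_on {0..L} h1" "smooth_on {0..L} h2" for h1 h2
    using conjunct1[OF f] that by blast
  have scale: "df (\<lambda>S. c *\<^sub>R h S) = c * df h" if "smooth_on {0..L} h" for c h
    using conjunct1[OF conjunct2[OF f]] that by blast
  \<comment> \<open>The order \<open>k\<close> is fixed first: the bound on \<open>df\<close> and
    the approximation of \<open>f\<close> refer to the same norm.\<close>
  obtain k where "\<exists>C. \<forall>h. smooth_on {0..L} h \<longrightarrow> \<bar>df h\<bar> \<le> C * Ck_norm k L h"
    and approx: "\<forall>e>0. \<exists>d>0. \<forall>h. smooth_on {0..L} h \<longrightarrow> Ck_norm k L h < d \<longrightarrow>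
      \<bar>f (\<lambda>S. F S t + h S) - f (\<lambda>s. F s t) - df h\<bar> \<le> e * Ck_norm k L h"
    by (rule exE[OF conjunct2[OF conjunct2[OF f]]], erule conjE, rule that)
  then obtain C where C: "\<forall>h. smooth_on {0..L} h \<longrightarrow> \<bar>df h\<bar> \<le> C * Ck_norm k L h"
    by (elim exE)
  obtain M where M: "M > 0"
    and r: "\<And>e. e > 0 \<Longrightarrow> \<forall>\<^sub>F \<tau> in at t within T.
      0 \<le> Ck_norm k L (?r \<tau>) \<and> Ck_norm k L (?r \<tau>) \<le> e * \<bar>\<tau> - t\<bar>"
    and h: "\<forall>\<^sub>F \<tau> in at t within T. 0 \<le> Ck_norm k L (?h \<tau>) \<and> Ck_norm k L (?h \<tau>) \<le> M * \<bar>\<tau> - t\<bar>"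
    by (rule Ck_norm_time_increment[OF F t, of k]) (rule that)
  have smooth_scale: "smooth_on {0..L} (\<lambda>s. c *\<^sub>R u s)" if "smooth_on {0..L} u" for c and u :: "real \<Rightarrow> real^3"
    using smooth_on_linear[OF bounded_linear_scaleR_right that] .
  have w: "smooth_on {0..L} ?w"
    by (rule smooth_field_slice[OF smooth_field_dt[OF F] t])
  have smooth_h: "smooth_on {0..L} (?h \<tau>)" if "\<tau> \<in> T" for \<tau>
    using smooth_on_add[OF smooth_field_slice[OF F that] smooth_scale[OF smooth_field_slice[OF F t], of "-1"]]
    by simp
  have smooth_r: "smooth_on {0..L} (?r \<tau>)" if "\<tau> \<in> T" for \<tau>
    using smooth_on_add[OF smooth_h[OF that] smooth_scale[OF w, of "- (\<tau> - t)"]]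
    unfolding scaleR_minus_left add_uminus_conv_diff .
  have "\<forall>\<^sub>F \<tau> in at t within T.
      \<bar>f (\<lambda>s. F s \<tau>) - f (\<lambda>s. F s t) - (\<tau> - t) * df ?w\<bar> \<le> e * \<bar>\<tau> - t\<bar>" if e: "e > 0" for e
  proof -
    \<comment> \<open>Each of the two errors receives half of \<open>e\<close>;
      \<open>\<bar>C\<bar> + 1\<close> is positive whatever the sign of \<open>C\<close>.\<close>
    define e1 where "e1 = e / (2 * M)"
    define e2 where "e2 = e / (2 * (\<bar>C\<bar> + 1))"
    have pos: "e1 > 0" "e2 > 0" using e M by (auto simp: e1_def e2_def add_nonneg_pos)
    obtain d where d: "d > 0" "\<forall>h. smooth_on {0..L} h \<longrightarrow> Ck_norm k L h < d \<longrightarrow>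
      \<bar>f (\<lambda>S. F S t + h S) - f (\<lambda>s. F s t) - df h\<bar> \<le> e1 * Ck_norm k L h"
      using approx pos(1) by blast
    \<comment> \<open>Within this radius the norm of the increment stays below
      \<open>d\<close>.\<close>
    have "\<forall>\<^sub>F \<tau> in at t within T. dist \<tau> t < d / M \<and> \<tau> \<in> T"
      using d(1) M eventually_at_ball'[of "d / M" t T] by (auto simp: dist_commute elim: eventually_mono)
    then show ?thesis
      using h r[OF pos(2)]
    proof eventually_elim
      case (elim \<tau>)
      then have \<tau>: "\<tau> \<in> T" and "M * \<bar>\<tau> - t\<bar> < d"
        using M by (auto simp: dist_real_def field_simps)
      then have "\<bar>f (\<lambda>S. F S t + ?h \<tau> S) - f (\<lambda>s. F s t) - df (?h \<tau>)\<bar> \<le> e1 * Ck_norm k L (?h \<tau>)"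
        using elim by (intro d(2)[rule_format] smooth_h) auto
      also have "\<dots> \<le> e1 * (M * \<bar>\<tau> - t\<bar>)"
        using elim pos by (intro mult_left_mono) auto
      finally have 1: "\<bar>f (\<lambda>s. F s \<tau>) - f (\<lambda>s. F s t) - df (?h \<tau>)\<bar> \<le> e / 2 * \<bar>\<tau> - t\<bar>"
        using M by (simp add: e1_def)
      have "df (?h \<tau>) = df (\<lambda>s. ?r \<tau> s + (\<tau> - t) *\<^sub>R ?w s)" by simp
      also have "\<dots> = df (?r \<tau>) + df (\<lambda>s. (\<tau> - t) *\<^sub>R ?w s)"
        by (rule add[OF smooth_r[OF \<tau>] smooth_scale[OF w]])
      also have "\<dots> = df (?r \<tau>) + (\<tau> - t) * df ?w"
        by (simp only: scale[OF w])
      finally have 2: "df (?h \<tau>) = df (?r \<tau>) + (\<tau> - t) * df ?w" .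
      have "\<bar>df (?r \<tau>)\<bar> \<le> (\<bar>C\<bar> + 1) * (e2 * \<bar>\<tau> - t\<bar>)"
      proof -
        have "\<bar>df (?r \<tau>)\<bar> \<le> C * Ck_norm k L (?r \<tau>)"
          using C smooth_r[OF \<tau>] by blast
        also have "\<dots> \<le> (\<bar>C\<bar> + 1) * Ck_norm k L (?r \<tau>)"
          using elim by (intro mult_right_mono) auto
        also have "\<dots> \<le> (\<bar>C\<bar> + 1) * (e2 * \<bar>\<tau> - t\<bar>)"
          using elim by (intro mult_left_mono) auto
        finally show ?thesis .
      qed
      also have "\<dots> = e / 2 * \<bar>\<tau> - t\<bar>"
        by (simp add: e2_def field_simps)
      finally show ?case
        using 1 2 by linarith
    qed
  qed
  then have "((\<lambda>\<tau>. f (\<lambda>s. F s \<tau>)) has_derivative (\<lambda>x. x * df ?w)) (at t within T)"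
    unfolding has_derivative_within_alt2 by (simp add: bounded_linear_mult_left)
  then show ?thesis
    by (simp add: has_field_derivative_def mult_commute_abs)
qed

section \<open>Closure of smooth fields under linear and bilinear operations\<close>

lemma smooth_field_linear:
  "bounded_linear h \<Longrightarrow> smooth_field U \<Longrightarrow> smooth_field (\<lambda>S t. h (U S t))"
  using smooth_on_linear[of h "{0..L} \<times> T" "case_prod U"] by (simp add: case_prod_unfold)

lemma smooth_field_bilinear:
  "bounded_bilinear h \<Longrightarrow> smooth_field U \<Longrightarrow> smooth_field V \<Longrightarrow>
    smooth_field (\<lambda>S t. h (U S t) (V S t))"
  using smooth_on_bilinear[of h "{0..L} \<times> T" "case_prod U" "case_prod V"]
  by (simp add: case_prod_unfold)

lemma smooth_field_cong:
  assumes "smooth_field U" "\<And>S t. S \<in> {0..L} \<Longrightarrow> t \<in> T \<Longrightarrow> U S t = V S t"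
  shows "smooth_field V"
  using assms(1) by (rule smooth_on_cong) (use assms(2) in auto)

end

section \<open>Evolution of the curvature\<close>

locale moving_frame = strip L T for L T +
  fixes R :: "real \<Rightarrow> real \<Rightarrow> real^3^3"
  assumes smooth_R: "smooth_field R"
    and rotation_R: "\<And>S t. S \<in> {0..L} \<Longrightarrow> t \<in> T \<Longrightarrow> rotation_matrix (R S t)"
begin

lemmas R_inverse = rotation_matrix_inverse[OF rotation_R]

lemma R_inverse_vector:
  assumes "S \<in> {0..L}" "t \<in> T"
  shows "R S t *v (y v* R S t) = y"
  unfolding transpose_matrix_vector[symmetric] matrix_vector_mul_assoc R_inverse(3)[OF assms]
  by (rule matrix_vector_mul_lid)

lemma cross3_R:
  "S \<in> {0..L} \<Longrightarrow> t \<in> T \<Longrightarrow>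
    R S t *v cross3 x y = cross3 (R S t *v x) (R S t *v y)"
  by (simp add: cross_rotation_matrix rotation_R)

text \<open>Differentiate the constant product \<open>transpose R ** R\<close> in space.\<close>

lemma R_dS_skew:
  assumes S: "S \<in> {0..L}" and t: "t \<in> T"
  shows "transpose (R S t) ** dS L R S t \<in> so3"
proof -
  note D = has_dS[OF smooth_R S t]
  have "((\<lambda>s. transpose (R s t) ** R s t) has_vector_derivative
      transpose (R S t) ** dS L R S t + transpose (dS L R S t) ** R S t) (at S within {0..L})"
    by (rule bounded_bilinear.has_vector_derivative[OF bounded_bilinear_matrix_mult
        bounded_linear.has_vector_derivative[OF bounded_linear_transpose D] D])
  moreover have "((\<lambda>s. transpose (R s t) ** R s t) has_vector_derivative 0) (at S within {0..L})"
    by (rule has_vector_derivative_transform[OF S _ has_vector_derivative_const[of "mat 1"]])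
      (simp add: R_inverse(2) t)
  ultimately have "transpose (R S t) ** dS L R S t + transpose (dS L R S t) ** R S t = 0"
    by (rule vector_derivative_unique_within[OF space_not_isolated[OF S]])
  then have "transpose (dS L R S t) ** R S t = - (transpose (R S t) ** dS L R S t)"
    by (simp only: add_eq_0_iff)
  then show ?thesis
    by (simp only: so3_def mem_Collect_eq matrix_transpose_mul transpose_transpose)
qed

text \<open>On the strip the inverse becomes a transpose and \<open>j_map\<close> becomes
  \<open>axial\<close>, leaving only linear and bilinear operations on \<open>R\<close> and its
  space derivative.\<close>

lemma curvature_eq:
  "S \<in> {0..L} \<Longrightarrow> t \<in> T \<Longrightarrow>
    curvature L R S t = R S t *v axial (transpose (R S t) ** dS L R S t)"
  by (simp add: curvature_def bold_def R_inverse(1) j_map_so3 R_dS_skew)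

lemma smooth_curvature: "smooth_field (curvature L R)"
proof (rule smooth_field_cong)
  show "smooth_field (\<lambda>S t. R S t *v axial (transpose (R S t) ** dS L R S t))"
    by (intro smooth_field_bilinear[OF bounded_bilinear_matrix_vector_mult]
        smooth_field_bilinear[OF bounded_bilinear_matrix_mult]
        smooth_field_linear[OF bounded_linear_axial] smooth_field_linear[OF bounded_linear_transpose]
        smooth_field_dS smooth_R)
qed (simp add: curvature_eq)

lemma smooth_tensor:
  assumes "smooth_field u"
  shows "smooth_field (tensor R X u)"
proof (rule smooth_field_cong)
  show "smooth_field (\<lambda>S t. R S t *v (X *v (transpose (R S t) *v u S t)))"
    by (intro smooth_field_bilinear[OF bounded_bilinear_matrix_vector_mult]
        smooth_field_linear[OF matrix_vector_mul_bounded_linear]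
        smooth_field_linear[OF bounded_linear_transpose] smooth_R assms)
qed (simp add: tensor_def bold_def moving_def R_inverse(1))

text \<open>In moving components the derivative acts by the cross product with the axial vector;
  rotations preserve cross products, so applying \<open>R\<close> gives the ambient form.\<close>

lemma dS_R_eq_curvature_cross:
  assumes "S \<in> {0..L}" "t \<in> T"
  shows "dS L R S t *v x = cross3 (curvature L R S t) (R S t *v x)"
proof -
  have "dS L R S t *v x = R S t *v ((transpose (R S t) ** dS L R S t) *v x)"
    by (simp add: R_inverse_vector[OF assms] flip: matrix_vector_mul_assoc)
  then show ?thesis
    by (simp add: axial_cross[OF R_dS_skew[OF assms]] cross3_R[OF assms] curvature_eq[OF assms])
qed

text \<open>The time analogue: \<open>j_inv\<close> acts as a cross product with the moving
  components of \<open>\<omega>\<close>, and \<open>R\<close> carries them back to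
  \<open>\<omega>\<close>.\<close>

lemma dt_R_eq_cross:
  assumes "S \<in> {0..L}" "t \<in> T"
    and "dt T R S t = R S t ** j_inv (moving R \<omega> S t)"
  shows "dt T R S t *v x = cross3 (\<omega> S t) (R S t *v x)"
  using assms(1,2)
  by (simp add: assms(3) j_inv_eq_hat hat_mult_vector cross3_R moving_def R_inverse(1)
      R_inverse_vector flip: matrix_vector_mul_assoc)

text \<open>Compatibility \<open>\<partial>\<^sub>t\<partial>\<^sub>S(Rx) = \<partial>\<^sub>S\<partial>\<^sub>t(Rx)\<close> for every
  constant \<open>x\<close>, followed by the Jacobi identity.\<close>

lemma curvature_evolution:
  assumes smooth_\<omega>: "smooth_field \<omega>"
    and motion: "\<And>S t. S \<in> {0..L} \<Longrightarrow> t \<in> T \<Longrightarrow>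
      dt T R S t = R S t ** j_inv (moving R \<omega> S t)"
    and S: "S \<in> {0..L}" and t: "t \<in> T"
  shows "dt T (curvature L R) S t = dS L \<omega> S t + cross3 (\<omega> S t) (curvature L R S t)"
proof -
  define \<kappa> where "\<kappa> = curvature L R"
  note cross_vd = bounded_bilinear.has_vector_derivative[OF bounded_bilinear_cross3]
  have "cross3 (dt T \<kappa> S t) y = cross3 (dS L \<omega> S t + cross3 (\<omega> S t) (\<kappa> S t)) y" for y
  proof -
    \<comment> \<open>This \<open>x\<close> is frozen at the point \<open>(S, t)\<close>: it stays
      constant under differentiation, while \<open>r\<close> takes the arbitrary value
      \<open>y\<close> there.\<close>
    define x where "x = transpose (R S t) *v y"
    define r where "r = (\<lambda>S t. R S t *v x)"
    have lin: "bounded_linear (\<lambda>M :: real^3^3. M *v x)"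
      by (rule bounded_bilinear.bounded_linear_left[OF bounded_bilinear_matrix_vector_mult])
    have smooth_r: "smooth_field r"
      unfolding r_def by (rule smooth_field_linear[OF lin smooth_R])
    have r: "r S t = y"
      unfolding r_def x_def transpose_matrix_vector by (rule R_inverse_vector[OF S t])
    have dS_r: "dS L r s \<tau> = cross3 (\<kappa> s \<tau>) (r s \<tau>)" if "s \<in> {0..L}" "\<tau> \<in> T" for s \<tau>
      unfolding r_def \<kappa>_def dS_R_eq_curvature_cross[OF that, symmetric]
      by (rule dS_eq[OF that(1)], rule bounded_linear.has_vector_derivative[OF lin has_dS[OF smooth_R that]])
    have dt_r: "dt T r s \<tau> = cross3 (\<omega> s \<tau>) (r s \<tau>)" if "s \<in> {0..L}" "\<tau> \<in> T" for s \<tau>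
      unfolding r_def dt_R_eq_cross[OF that motion[OF that], symmetric]
      by (rule dt_eq[OF that(2)], rule bounded_linear.has_vector_derivative[OF lin has_dt[OF smooth_R that]])
    \<comment> \<open>The formulas \<open>dS_r\<close> and \<open>dt_r\<close> hold along whole time
      and space slices, so each may be differentiated in the other variable by the product
      rule.\<close>
    have "dt T (dS L r) S t = cross3 (\<kappa> S t) (dt T r S t) + cross3 (dt T \<kappa> S t) (r S t)"
      using cross_vd[OF has_dt[OF smooth_curvature S t] has_dt[OF smooth_r S t]]
      by (intro dt_eq[OF t] has_vector_derivative_transform[OF t dS_r[OF S]]) (simp_all add: \<kappa>_def)
    moreover have "dS L (dt T r) S t = cross3 (\<omega> S t) (dS L r S t) + cross3 (dS L \<omega> S t) (r S t)"
      using cross_vd[OF has_dS[OF smooth_\<omega> S t] has_dS[OF smooth_r S t]]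
      by (intro dS_eq[OF S] has_vector_derivative_transform[OF S dt_r[OF _ t]]) simp_all
    ultimately have "cross3 (\<kappa> S t) (cross3 (\<omega> S t) y) + cross3 (dt T \<kappa> S t) y =
        cross3 (\<omega> S t) (cross3 (\<kappa> S t) y) + cross3 (dS L \<omega> S t) y"
      using dt_dS_commute[OF smooth_r S t] by (simp add: dS_r[OF S t] dt_r[OF S t] r)
    then have "cross3 (dt T \<kappa> S t) y = cross3 (dS L \<omega> S t) y +
        (cross3 (\<omega> S t) (cross3 (\<kappa> S t) y) - cross3 (\<kappa> S t) (cross3 (\<omega> S t) y))"
      by (simp add: algebra_simps)
    also have "cross3 (\<omega> S t) (cross3 (\<kappa> S t) y) - cross3 (\<kappa> S t) (cross3 (\<omega> S t) y) =
        cross3 (cross3 (\<omega> S t) (\<kappa> S t)) y"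
      by (rule cross3_commutator)
    finally show ?thesis
      by (simp add: cross_add_left)
  qed
  then show ?thesis
    unfolding \<kappa>_def by (rule cross3_eqI)
qed

end

section \<open>Time derivative of a test function along the curvature\<close>

theorem proposition4p6:
  fixes L G A E \<rho> I1 I2 I3 :: real
    and T :: "real set"
    and \<phi> p \<sigma> \<epsilon> \<kappa> \<omega> :: "real \<Rightarrow> real \<Rightarrow> real^3"
    and R :: "real \<Rightarrow> real \<Rightarrow> real^3^3"
    and GG HH AA JJ :: "real^3^3"
    and f :: "(real \<Rightarrow> real^3) \<Rightarrow> real"
    and grad :: "(real \<Rightarrow> real^3) \<Rightarrow> (real \<Rightarrow> real^3)"
  assumes "L > 0" and "is_interval T" and "interior T \<noteq> {}"
    and "G > 0" "A > 0" "E > 0" "\<rho> > 0" "I1 > 0" "I2 > 0" "I3 > 0"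
  defines "GG \<equiv> diag3 (G * A) (G * A) (E * A)"
    and "HH \<equiv> diag3 (E * I1) (E * I2) (G * I3)"
    and "AA \<equiv> (\<rho> * A) *\<^sub>R mat 1"
    and "JJ \<equiv> \<rho> *\<^sub>R diag3 I1 I2 I3"
    and "\<epsilon> \<equiv> strain L \<phi> R"
    and "\<kappa> \<equiv> curvature L R"
    and "\<omega> \<equiv> tensor R (matrix_inv JJ) \<sigma>"
  assumes rotation: "\<And>S t. S \<in> {0..L} \<Longrightarrow> t \<in> T \<Longrightarrow> rotation_matrix (R S t)"
    and smooth: "smooth_on ({0..L} \<times> T) (\<lambda>(S, t). \<phi> S t)"
      "smooth_on ({0..L} \<times> T) (\<lambda>(S, t). p S t)"
      "smooth_on ({0..L} \<times> T) (\<lambda>(S, t). R S t)"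
      "smooth_on ({0..L} \<times> T) (\<lambda>(S, t). \<sigma> S t)"
    and motion: "\<And>S t. S \<in> {0..L} \<Longrightarrow> t \<in> T \<Longrightarrow> dt T \<phi> S t = tensor R (matrix_inv AA) p S t"
      "\<And>S t. S \<in> {0..L} \<Longrightarrow> t \<in> T \<Longrightarrow> dt T p S t = dS L (tensor R GG \<epsilon>) S t"
      "\<And>S t. S \<in> {0..L} \<Longrightarrow> t \<in> T \<Longrightarrow>
         dt T R S t = R S t ** j_inv (moving R (tensor R (matrix_inv JJ) \<sigma>) S t)"
      "\<And>S t. S \<in> {0..L} \<Longrightarrow> t \<in> T \<Longrightarrow>
         dt T \<sigma> S t = dS L (tensor R HH \<kappa>) S t + cross3 (dS L \<phi> S t) (tensor R GG \<epsilon> S t)"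
    and test_function: "\<And>u. smooth_on {0..L} u \<Longrightarrow> has_functional_gradient L f (grad u) u"
  shows "\<forall>t\<in>T.
    (\<lambda>S. grad (\<lambda>s. \<kappa> s t) S \<bullet> (dS L \<omega> S t + cross3 (\<omega> S t) (\<kappa> S t))) integrable_on {0..L} \<and>
    ((\<lambda>\<tau>. f (\<lambda>s. \<kappa> s \<tau>)) has_real_derivative
       integral {0..L} (\<lambda>S. grad (\<lambda>s. \<kappa> s t) S \<bullet> (dS L \<omega> S t + cross3 (\<omega> S t) (\<kappa> S t))))
      (at t within T)"
proof -
  have "moving_frame L T R"
  proof
    show "\<exists>c\<in>T. c \<noteq> t" for t
    proof (rule ccontr)
      assume "\<not> ?thesis"
      then have "T \<subseteq> {t}" by blast
      then have "interior T \<subseteq> interior {t}" by (rule interior_mono)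
      with \<open>interior T \<noteq> {}\<close> show False by simp
    qed
  qed (use assms(1,2) smooth(3) rotation in \<open>auto simp: is_interval_convex_1\<close>)
  then interpret moving_frame L T R .
  have smooth_\<omega>: "smooth_field \<omega>"
    unfolding \<omega>_def by (rule smooth_tensor[OF smooth(4)])
  have smooth_\<kappa>: "smooth_field \<kappa>"
    unfolding \<kappa>_def by (rule smooth_curvature)
  have evolution: "dt T \<kappa> S t = dS L \<omega> S t + cross3 (\<omega> S t) (\<kappa> S t)"
    if "S \<in> {0..L}" "t \<in> T" for S t
    unfolding \<kappa>_def using curvature_evolution[OF smooth_\<omega> motion(3)[folded \<omega>_def] that] .
  show ?thesis
  proof
    fix t assume t: "t \<in> T"
    obtain df where df: "has_functional_derivative L f df (\<lambda>s. \<kappa> s t)"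
      and grad: "\<forall>h. smooth_on {0..L} h \<longrightarrow> ((\<lambda>S. grad (\<lambda>s. \<kappa> s t) S \<bullet> h S) has_integral df h) {0..L}"
      using test_function[OF smooth_field_slice[OF smooth_\<kappa> t]]
      unfolding has_functional_gradient_def by blast
    \<comment> \<open>The gradient at the current curvature is paired with its time derivative, an
      admissible smooth direction.\<close>
    have "((\<lambda>S. grad (\<lambda>s. \<kappa> s t) S \<bullet> dt T \<kappa> S t) has_integral df (\<lambda>s. dt T \<kappa> s t)) {0..L}"
      using grad smooth_field_slice[OF smooth_field_dt[OF smooth_\<kappa>] t] by blast
    \<comment> \<open>The evolution law changes only the integrand on \<open>{0..L}\<close>; the
      argument of \<open>df\<close> stays as the chain rule produces it.\<close>
    then have int: "((\<lambda>S. grad (\<lambda>s. \<kappa> s t) S \<bullet> (dS L \<omega> S t + cross3 (\<omega> S t) (\<kappa> S t)))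
        has_integral df (\<lambda>s. dt T \<kappa> s t)) {0..L}"
      by (rule has_integral_eq[rotated]) (simp add: evolution t)
    show "(\<lambda>S. grad (\<lambda>s. \<kappa> s t) S \<bullet> (dS L \<omega> S t + cross3 (\<omega> S t) (\<kappa> S t))) integrable_on {0..L} \<and>
      ((\<lambda>\<tau>. f (\<lambda>s. \<kappa> s \<tau>)) has_real_derivative
         integral {0..L} (\<lambda>S. grad (\<lambda>s. \<kappa> s t) S \<bullet> (dS L \<omega> S t + cross3 (\<omega> S t) (\<kappa> S t))))
        (at t within T)"
      using int functional_chain_rule[OF smooth_\<kappa> t df]
      by (simp add: has_integral_integrable integral_unique)
  qed
qed

end
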